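(* Let $n,k$ be integers with $3\le k\le n-2$, and let $\mathcal X$ be an $n$-independent set of $d(n,k-2)+3$ nodes in the plane. Then at most three linearly independent polynomials in $\Pi_k$ vanish at all nodes of $\mathcal X$. Moreover, there are three such linearly independent polynomials if and only if either all the nodes of $\mathcal X$ lie in a curve of degree $k-1$, or all the nodes of $\mathcal X$ but three lie in a curve of degree $k-2$ (which is then a maximal curve for $\mathcal X$).
   Context: $\Pi_n$ denotes the space of real bivariate polynomials of total degree at most $n$; $N_n=\frac12(n+1)(n+2)$ and $d(n,k):=N_n-N_{n-k}=\frac12 k(2n+3-k)$. A curve of degree $k$ is identified with a polynomial of degree $k$; a curve passes through a node if the polynomial vanishes there. For a finite node set $\mathcal X$ and $A\in\mathcal X$, $p\in\Pi_n$ is an $n$-fundamental polynomial of $A$ if $p(A)=1$ and $p$ vanishes on $\mathcal X\setminus\{A\}$; $\mathcal X$ is $n$-independent if every node has an $n$-fundamental polynomial. Given an $n$-independent $\mathcal X$ with $\#\mathcal X\ge d(n,k)$, a curve of degree $k\le n$ is maximal if it passes through exactly $d(n,k)$ nodes of $\mathcal X$. *)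

theory Defs
  imports Complex_Main
begin

text \<open>A real bivariate polynomial is represented by its coefficient function
  c :: nat \<Rightarrow> nat \<Rightarrow> real, where c i j is the coefficient of x^i y^j.\<close>

type_synonym bipoly = "nat \<Rightarrow> nat \<Rightarrow> real"
type_synonym point = "real \<times> real"

definition inPi :: "nat \<Rightarrow> bipoly \<Rightarrow> bool" where
  "inPi n c \<longleftrightarrow> (\<forall>i j. n < i + j \<longrightarrow> c i j = 0)"

definition has_degree :: "bipoly \<Rightarrow> nat \<Rightarrow> bool" where
  "has_degree c m \<longleftrightarrow> inPi m c \<and> (\<exists>i j. i + j = m \<and> c i j \<noteq> 0)"

text \<open>Evaluation (meaningful for finitely supported coefficient functions).\<close>
definition peval :: "bipoly \<Rightarrow> point \<Rightarrow> real" where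
  "peval c A = (\<Sum>(i,j)\<in>{(i,j). c i j \<noteq> 0}. c i j * fst A ^ i * snd A ^ j)"

definition NN :: "nat \<Rightarrow> nat" where
  "NN n = (n + 1) * (n + 2) div 2"

definition dd :: "nat \<Rightarrow> nat \<Rightarrow> nat" where
  "dd n k = NN n - NN (n - k)"

definition fundamental :: "nat \<Rightarrow> point set \<Rightarrow> point \<Rightarrow> bipoly \<Rightarrow> bool" where
  "fundamental n X A p \<longleftrightarrow> inPi n p \<and> peval p A = 1 \<and> (\<forall>B\<in>X - {A}. peval p B = 0)"

definition n_independent :: "nat \<Rightarrow> point set \<Rightarrow> bool" where
  "n_independent n X \<longleftrightarrow> (\<forall>A\<in>X. \<exists>p. fundamental n X A p)"

definition lin_indep :: "(nat \<Rightarrow> bipoly) \<Rightarrow> nat \<Rightarrow> bool" where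
  "lin_indep P m \<longleftrightarrow>
     (\<forall>a :: nat \<Rightarrow> real. (\<forall>i j. (\<Sum>l<m. a l * P l i j) = 0) \<longrightarrow> (\<forall>l<m. a l = 0))"

definition vanishing :: "nat \<Rightarrow> point set \<Rightarrow> bipoly set" where
  "vanishing k X = {c. inPi k c \<and> (\<forall>A\<in>X. peval c A = 0)}"

end

theory Submission
  imports Defs "HOL-Computational_Algebra.Polynomial" "HOL-Library.Nat_Bijection"
    "HOL-Library.Product_Plus"
begin

text \<open>Let \<open>S\<close> be the set of leading monomials, for the graded order, of the polynomials vanishing on
  \<open>X\<close>. The maximal number of independent polynomials of degree at most \<open>k\<close> vanishing on \<open>X\<close> is the
  number of elements of \<open>S\<close> of degree at most \<open>k\<close>, and \<open>n\<close>-independence bounds \<open>#X\<close> by the number of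
  monomials of degree at most \<open>n\<close> outside \<open>S\<close>. As \<open>S\<close> is closed under multiplication by monomials,
  the number \<open>e d\<close> of its elements of degree \<open>d\<close> grows strictly once it is positive. Since
  \<open>d(n,k-2) + 3 = N\<^sub>n - (3 + 4 + \<dots> + (n-k+3))\<close>, this forces at most three elements up to degree \<open>k\<close>;
  if there are three and none of them has degree less than \<open>k\<close>, then \<open>e k = 3\<close> and
  \<open>e (k+1) = 4\<close>. In that case the three generators of degree \<open>k\<close> satisfy two linear relations,
  and are therefore \<open>q\<close> times three quadrics having at most three common zeros in \<open>X\<close>, with
  \<open>deg q = k-2\<close>.\<close>

section \<open>Bivariate polynomials and the graded monomial order\<close>

declare split_paired_All [simp del] split_paired_Ex [simp del]

text \<open>The outer variable is y and the inner one x, so \<open>mcoeff p (i, j)\<close> is the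
  coefficient of x^i y^j and \<open>curry (mcoeff p)\<close> is a \<open>bipoly\<close>. The type
  \<open>real poly poly\<close> is an integral domain, in which factors can be cancelled.\<close>

definition mcoeff :: "real poly poly \<Rightarrow> nat \<times> nat \<Rightarrow> real" where
  "mcoeff p u = coeff (coeff p (snd u)) (fst u)"

definition ev :: "real poly poly \<Rightarrow> point \<Rightarrow> real" where
  "ev p A = poly (poly p [:snd A:]) (fst A)"

definition cst :: "real \<Rightarrow> real poly poly" where
  "cst a = [:[:a:]:]"

definition xymon :: "nat \<times> nat \<Rightarrow> real poly poly" where
  "xymon u = monom (monom 1 (fst u)) (snd u)"

definition mdeg :: "nat \<times> nat \<Rightarrow> nat" where
  "mdeg u = fst u + snd u"

lemma mdeg_Pair [simp]: "mdeg (i, j) = i + j"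
  by (simp add: mdeg_def)

lemma mdeg_add [simp]: "mdeg (u + v) = mdeg u + mdeg v"
  by (simp add: mdeg_def)

lemma mcoeff_0 [simp]: "mcoeff 0 u = 0"
  and mcoeff_add [simp]: "mcoeff (p + q) u = mcoeff p u + mcoeff q u"
  and mcoeff_diff [simp]: "mcoeff (p - q) u = mcoeff p u - mcoeff q u"
  and mcoeff_uminus [simp]: "mcoeff (- p) u = - mcoeff p u"
  and mcoeff_cst_mult [simp]: "mcoeff (cst a * p) u = a * mcoeff p u"
  by (simp_all add: mcoeff_def cst_def)

lemma mcoeff_sum [simp]: "mcoeff (\<Sum>x\<in>F. f x) u = (\<Sum>x\<in>F. mcoeff (f x) u)"
  by (simp add: mcoeff_def coeff_sum)

lemma mcoeff_xymon [simp]: "mcoeff (xymon u) v = (if v = u then 1 else 0)"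
  by (auto simp: mcoeff_def xymon_def prod_eq_iff)

lemma mcoeff_mult:
  "mcoeff (p * q) (m, n) = (\<Sum>j\<le>n. \<Sum>i\<le>m. mcoeff p (i, j) * mcoeff q (m - i, n - j))"
  by (simp add: mcoeff_def coeff_mult coeff_sum)

lemma bipoly_eqI: "(\<And>u. mcoeff p u = mcoeff q u) \<Longrightarrow> p = q"
  by (intro poly_eqI) (metis fst_conv mcoeff_def snd_conv)

lemma ev_simps [simp]:
  "ev 0 A = 0" "ev (p + q) A = ev p A + ev q A" "ev (p - q) A = ev p A - ev q A"
  "ev (- p) A = - ev p A" "ev (p * q) A = ev p A * ev q A" "ev (cst a) A = a"
  by (simp_all add: ev_def cst_def)

lemma ev_sum [simp]: "ev (\<Sum>x\<in>F. f x) A = (\<Sum>x\<in>F. ev (f x) A)"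
  by (induction F rule: infinite_finite_induct) auto

lemma ev_xymon [simp]: "ev (xymon u) A = fst A ^ fst u * snd A ^ snd u"
  by (simp add: ev_def xymon_def poly_monom poly_power)

section \<open>Passing between coefficient functions and the polynomial ring\<close>

lemma finite_mdeg_le: "finite {u. mdeg u \<le> n}"
  by (rule finite_subset[of _ "{..n} \<times> {..n}"]) (auto simp: mdeg_def)

lemma finite_mcoeff: "finite {u. mcoeff p u \<noteq> 0}"
proof (rule finite_subset)
  show "{u. mcoeff p u \<noteq> 0} \<subseteq> prod.swap ` (SIGMA j:{..degree p}. {..degree (coeff p j)})"
  proof
    fix u assume "u \<in> {u. mcoeff p u \<noteq> 0}"
    then have nz: "coeff (coeff p (snd u)) (fst u) \<noteq> 0" by (simp add: mcoeff_def)
    then have "coeff p (snd u) \<noteq> 0" by auto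
    with nz have "(snd u, fst u) \<in> (SIGMA j:{..degree p}. {..degree (coeff p j)})"
      by (simp add: le_degree)
    then show "u \<in> prod.swap ` (SIGMA j:{..degree p}. {..degree (coeff p j)})"
      by (force simp: image_iff)
  qed
qed auto

lemma xymon_expansion:
  assumes "finite F" "{u. mcoeff p u \<noteq> 0} \<subseteq> F"
  shows "p = (\<Sum>u\<in>F. cst (mcoeff p u) * xymon u)"
  using assms by (intro bipoly_eqI) (auto simp: sum.delta' if_distrib cong: if_cong)

lemma peval_mcoeff: "peval (curry (mcoeff p)) A = ev p A"
proof -
  have "ev p A = (\<Sum>u\<in>{u. mcoeff p u \<noteq> 0}. mcoeff p u * (fst A ^ fst u * snd A ^ snd u))"
    by (subst xymon_expansion[OF finite_mcoeff order_refl]) simp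
  then show ?thesis
    by (simp add: peval_def case_prod_unfold mult.assoc)
qed

lemma bipoly_of_inPi:
  assumes "inPi n c"
  obtains p where "curry (mcoeff p) = c"
proof
  have "mcoeff (\<Sum>u\<in>{u. mdeg u \<le> n}. cst (case_prod c u) * xymon u) v = case_prod c v" for v
    using assms finite_mdeg_le[of n]
    by (auto simp: inPi_def sum.delta' if_distrib mdeg_def case_prod_unfold not_le cong: if_cong)
  then show "curry (mcoeff (\<Sum>u\<in>{u. mdeg u \<le> n}. cst (case_prod c u) * xymon u)) = c"
    by (simp add: curry_def)
qed

lemma inPi_mcoeff: "inPi n (curry (mcoeff p)) \<longleftrightarrow> (\<forall>u. mcoeff p u \<noteq> 0 \<longrightarrow> mdeg u \<le> n)"
  by (auto simp: inPi_def mdeg_def not_less dest: leD) (meson not_le)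

text \<open>Gaussian elimination, removing one equation t and one pivot unknown z at a time. The
  dimension counts below rest on it.\<close>

lemma underdetermined_system:
  fixes c :: "'a \<Rightarrow> 'b \<Rightarrow> real"
  assumes "finite N" "finite J" "card N < card J"
  shows "\<exists>a. (\<exists>x\<in>J. a x \<noteq> 0) \<and> (\<forall>s\<in>N. (\<Sum>x\<in>J. a x * c x s) = 0)"
  using assms
proof (induction N arbitrary: J c rule: finite_induct)
  case empty
  then obtain x where "x \<in> J" by fastforce
  then show ?case by (intro exI[of _ "\<lambda>_. 1"]) auto
next
  case (insert t N)
  show ?case
  proof (cases "\<exists>z\<in>J. c z t \<noteq> 0")
    case False
    from insert have "card N < card J" by simp
    from insert.IH[OF insert.prems(1) this, of c] False show ?thesis by fastforce
  next
    case True
    then obtain z where z: "z \<in> J" "c z t \<noteq> 0" by blast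
    \<comment> \<open>Coefficients of equation s once z has been expressed through the other
      unknowns by equation t.\<close>
    define d where "d x s = c x s - c x t / c z t * c z s" for x s
    have "card N < card (J - {z})"
      using insert z by simp
    with insert.IH[of "J - {z}" d] insert.prems obtain a where
      a: "\<exists>x\<in>J - {z}. a x \<noteq> 0" "\<forall>s\<in>N. (\<Sum>x\<in>J - {z}. a x * d x s) = 0"
      by auto
    \<comment> \<open>Back substitution: the value at z is the one that satisfies equation
      t.\<close>
    define b where "b = a(z := - (\<Sum>x\<in>J - {z}. a x * c x t) / c z t)"
    have split: "(\<Sum>x\<in>J. b x * c x s) = b z * c z s + (\<Sum>x\<in>J - {z}. a x * c x s)" for s
    proof -
      have "(\<Sum>x\<in>J - {z}. b x * c x s) = (\<Sum>x\<in>J - {z}. a x * c x s)"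
        by (rule sum.cong) (auto simp: b_def)
      with sum.remove[OF insert.prems(1) z(1), of "\<lambda>x. b x * c x s"] show ?thesis by simp
    qed
    have "(\<Sum>x\<in>J. b x * c x s) = 0" if "s \<in> N" for s
    proof -
      have "(\<Sum>x\<in>J - {z}. a x * d x s)
          = (\<Sum>x\<in>J - {z}. a x * c x s) - (\<Sum>x\<in>J - {z}. a x * c x t) / c z t * c z s"
        by (simp add: d_def algebra_simps sum_subtractf sum_distrib_left sum_distrib_right sum_divide_distrib)
      with a(2) that show ?thesis
        unfolding split by (simp add: b_def)
    qed
    moreover have "(\<Sum>x\<in>J. b x * c x t) = 0"
      unfolding split using z by (simp add: b_def)
    moreover have "\<exists>x\<in>J. b x \<noteq> 0"
      using a(1) by (auto simp: b_def)
    ultimately show ?thesis by (intro exI[of _ b]) auto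
  qed
qed

text \<open>\<open>prod_encode (a, b)\<close> is \<open>triangle (a + b) + a\<close>, and
  \<open>triangle s + a < triangle (s + 1)\<close> whenever a \<le> s.\<close>

lemma prod_encode_less_iff:
  "prod_encode u < prod_encode v \<longleftrightarrow> mdeg u < mdeg v \<or> mdeg u = mdeg v \<and> fst u < fst v"
proof -
  have tri: "triangle a + a < triangle b" if "a < b" for a b
  proof -
    have "triangle (Suc a) \<le> triangle b"
      using lift_Suc_mono_le[of triangle "Suc a" b] that by simp
    then show ?thesis by simp
  qed
  obtain a b c d where uv: "u = (a, b)" "v = (c, d)" by (metis surj_pair)
  consider "a + b < c + d" | "c + d < a + b" | "a + b = c + d" by linarith
  then show ?thesis
    using tri[of "a + b" "c + d"] tri[of "c + d" "a + b"]
    by cases (auto simp: prod_encode_def uv)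
qed

lemma prod_encode_le_iff:
  "prod_encode u \<le> prod_encode v \<longleftrightarrow> mdeg u < mdeg v \<or> mdeg u = mdeg v \<and> fst u \<le> fst v"
  using prod_encode_less_iff[of v u] by linarith

text \<open>\<^const>\<open>prod_encode\<close> enumerates the exponent pairs by total degree and then by the first
  exponent, so comparing codes is the graded lexicographic monomial order.\<close>

definition lead :: "real poly poly \<Rightarrow> nat \<times> nat \<Rightarrow> bool" where
  "lead p u \<longleftrightarrow> mcoeff p u \<noteq> 0 \<and> (\<forall>v. mcoeff p v \<noteq> 0 \<longrightarrow> prod_encode v \<le> prod_encode u)"

lemma lead_nonzero: "lead p u \<Longrightarrow> mcoeff p u \<noteq> 0"
  and lead_le: "lead p u \<Longrightarrow> mcoeff p v \<noteq> 0 \<Longrightarrow> prod_encode v \<le> prod_encode u"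
  by (auto simp only: lead_def)

lemma ex_max_prod_encode:
  assumes "finite F" "F \<noteq> {}"
  shows "\<exists>x\<in>F. \<forall>y\<in>F. prod_encode (h y) \<le> prod_encode (h x)"
proof -
  let ?M = "(prod_encode \<circ> h) ` F"
  have "Max ?M \<in> ?M"
    using assms by (intro Max_in) auto
  then obtain x where x: "x \<in> F" "prod_encode (h x) = Max ?M" by auto
  then have "\<forall>y\<in>F. prod_encode (h y) \<le> prod_encode (h x)"
    using assms(1) by auto
  with x(1) show ?thesis by blast
qed

lemma lead_exists:
  assumes "p \<noteq> 0"
  obtains u where "lead p u"
proof -
  have "{u. mcoeff p u \<noteq> 0} \<noteq> {}" using assms bipoly_eqI[of p 0] by auto
  with ex_max_prod_encode[OF finite_mcoeff this, of id] show thesis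
    by (auto simp: lead_def intro: that)
qed

lemma lead_unique: "lead p u \<Longrightarrow> lead p v \<Longrightarrow> u = v"
  by (metis lead_def order_antisym prod_encode_eq)

lemma lead_mdeg: "lead p u \<Longrightarrow> mcoeff p v \<noteq> 0 \<Longrightarrow> mdeg v \<le> mdeg u"
  using lead_le[of p u v] by (auto simp: prod_encode_le_iff)

text \<open>The order is compatible with addition of exponents, so the top coefficient of a product
  receives a single contribution.\<close>

lemma lead_mult:
  assumes p: "lead p u" and q: "lead q v"
  shows "lead (p * q) (u + v)" and "mcoeff (p * q) (u + v) = mcoeff p u * mcoeff q v"
proof -
  \<comment> \<open>Among products of terms landing at or above u + v, only that of the two leading
    terms can be nonzero.\<close>
  have key: "(i, j) = u \<and> (m, n) = u + v"
    if "mcoeff p (i, j) * mcoeff q (m - i, n - j) \<noteq> 0" "i \<le> m" "j \<le> n"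
      and "prod_encode (u + v) \<le> prod_encode (m, n)" for i j m n
  proof -
    have "prod_encode (i, j) \<le> prod_encode u" "prod_encode (m - i, n - j) \<le> prod_encode v"
      using that p q by (auto simp: lead_def)
    with that(2-) show ?thesis
      by (auto simp: prod_encode_le_iff mdeg_def prod_eq_iff)
  qed
  have "mcoeff (p * q) w = 0" if "prod_encode (u + v) < prod_encode w" for w
  proof -
    obtain m n where w: "w = (m, n)" by fastforce
    have "mcoeff p (i, j) * mcoeff q (m - i, n - j) = 0" if "i \<le> m" "j \<le> n" for i j
      using key[of i j m n] that \<open>prod_encode (u + v) < prod_encode w\<close> unfolding w
      by (metis less_irrefl less_imp_le)
    then show ?thesis unfolding w mcoeff_mult by (intro sum.neutral ballI) simp
  qed
  moreover show eq: "mcoeff (p * q) (u + v) = mcoeff p u * mcoeff q v"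
  proof -
    obtain a b c d where uv: "u = (a, b)" "v = (c, d)" by (metis surj_pair)
    have "mcoeff (p * q) (u + v) = (\<Sum>j\<le>b + d. \<Sum>i\<le>a + c.
        if i = a then if j = b then mcoeff p u * mcoeff q v else 0 else 0)"
      unfolding uv add_Pair mcoeff_mult
    proof (intro sum.cong refl)
      fix i j assume "j \<in> {..b + d}" "i \<in> {..a + c}"
      then show "mcoeff p (i, j) * mcoeff q (a + c - i, b + d - j)
          = (if i = a then if j = b then mcoeff p (a, b) * mcoeff q (c, d) else 0 else 0)"
        using key[of i j "a + c" "b + d"]
        by (cases "mcoeff p (i, j) * mcoeff q (a + c - i, b + d - j) = 0") (auto simp: uv)
    qed
    then show ?thesis by (simp add: sum.delta)
  qed
  ultimately show "lead (p * q) (u + v)"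
    using p q unfolding lead_def by (metis mult_eq_0_iff not_le)
qed

lemma lead_xymon: "lead (xymon u) u"
  by (simp add: lead_def)

text \<open>The largest \<open>h y\<close> with \<open>b y \<noteq> 0\<close> occurs in no other
  summand with a nonzero coefficient, so its term could not cancel.\<close>

lemma lead_family_independent:
  assumes "finite F" "inj_on h F" and lead: "\<And>x. x \<in> F \<Longrightarrow> lead (G x) (h x)"
    and zero: "(\<Sum>x\<in>F. cst (b x) * G x) = 0" and "x \<in> F"
  shows "b x = 0"
proof (rule ccontr)
  assume "b x \<noteq> 0"
  then have "finite {x\<in>F. b x \<noteq> 0}" "{x\<in>F. b x \<noteq> 0} \<noteq> {}"
    using assms by auto
  from ex_max_prod_encode[OF this, of h] obtain y where y: "y \<in> F" "b y \<noteq> 0"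
    and max: "\<And>z. z \<in> F \<Longrightarrow> b z \<noteq> 0 \<Longrightarrow> prod_encode (h z) \<le> prod_encode (h y)"
    by auto
  have "b z * mcoeff (G z) (h y) = 0" if "z \<in> F - {y}" for z
  proof (rule ccontr)
    assume *: "b z * mcoeff (G z) (h y) \<noteq> 0"
    then have "prod_encode (h z) = prod_encode (h y)"
      using that max[of z] lead_le[OF lead[of z], of "h y"] by simp
    then show False
      using that y(1) inj_onD[OF assms(2), of z y] by (simp add: prod_encode_eq)
  qed
  then have "(\<Sum>x\<in>F. b x * mcoeff (G x) (h y)) = b y * mcoeff (G y) (h y)"
    unfolding sum.remove[OF assms(1) y(1), of "\<lambda>x. b x * mcoeff (G x) (h y)"]
    by (subst sum.neutral) auto
  also have "\<dots> \<noteq> 0"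
    using y lead[of y] by (simp add: lead_def)
  finally show False
    using arg_cong[OF zero, of "\<lambda>p. mcoeff p (h y)"] by simp
qed

section \<open>Leading monomials of the vanishing ideal\<close>

text \<open>The exponents of the initial ideal of the vanishing ideal of Z. The exponents outside it
  are the standard monomials, against which nodes are counted.\<close>

definition lead_mons :: "point set \<Rightarrow> (nat \<times> nat) set" where
  "lead_mons Z = {u. \<exists>p. (\<forall>A\<in>Z. ev p A = 0) \<and> lead p u}"

lemma lead_mons_add: "u \<in> lead_mons Z \<Longrightarrow> u + v \<in> lead_mons Z"
proof -
  assume "u \<in> lead_mons Z"
  then obtain p where p: "\<forall>A\<in>Z. ev p A = 0" "lead p u" unfolding lead_mons_def by blast
  from p(1) have "\<forall>A\<in>Z. ev (p * xymon v) A = 0" by simp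
  with lead_mult(1)[OF p(2) lead_xymon[of v]] show ?thesis unfolding lead_mons_def by blast
qed

lemma lead_mons_choice:
  obtains G where "\<And>u A. u \<in> lead_mons Z \<Longrightarrow> A \<in> Z \<Longrightarrow> ev (G u) A = 0"
    and "\<And>u. u \<in> lead_mons Z \<Longrightarrow> lead (G u) u"
proof -
  have "\<forall>u\<in>lead_mons Z. \<exists>p. (\<forall>A\<in>Z. ev p A = 0) \<and> lead p u"
    by (simp add: lead_mons_def)
  from bchoice[OF this] that show thesis by blast
qed

text \<open>The leading monomial of a nonzero polynomial vanishing on Z would lie in
  \<open>lead_mons Z\<close>. So an element of the vanishing ideal is determined by its coefficients
  there, which turns dimensions into numbers of exponents.\<close>

lemma eq_0_if_no_lead_mons:
  assumes "\<And>A. A \<in> Z \<Longrightarrow> ev p A = 0" and "\<And>u. u \<in> lead_mons Z \<Longrightarrow> mcoeff p u = 0"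
  shows "p = 0"
proof (rule ccontr)
  assume "p \<noteq> 0"
  then obtain u where "lead p u" by (rule lead_exists)
  with assms(1) have "u \<in> lead_mons Z" unfolding lead_mons_def by blast
  with assms(2) \<open>lead p u\<close> show False by (simp add: lead_def)
qed

section \<open>Numbers of nodes and of standard monomials\<close>

lemma fundamentalE:
  assumes "fundamental n X A c"
  obtains p where "\<And>u. mcoeff p u \<noteq> 0 \<Longrightarrow> mdeg u \<le> n" "ev p A = 1"
    "\<And>B. B \<in> X - {A} \<Longrightarrow> ev p B = 0"
proof -
  from assms have c: "inPi n c" "peval c A = 1" "\<And>B. B \<in> X - {A} \<Longrightarrow> peval c B = 0"
    by (auto simp: fundamental_def)
  obtain p where "curry (mcoeff p) = c" using bipoly_of_inPi[OF c(1)] .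
  with c show thesis
    using inPi_mcoeff[of n p] peval_mcoeff[of p] by (intro that[of p]) metis+
qed

text \<open>Otherwise the fundamental polynomials of the nodes, together with one vanishing
  polynomial per leading monomial of degree at most n, would outnumber the monomials of degree at
  most n and be dependent. Evaluation at the nodes kills the coefficients of the former,
  distinctness of leading monomials those of the latter.\<close>

lemma card_n_independent_le:
  assumes "finite Z" "n_independent n Z"
  shows "card Z \<le> card ({u. mdeg u \<le> n} - lead_mons Z)"
proof (rule ccontr)
  let ?N = "{u. mdeg u \<le> n}"
  let ?S = "?N \<inter> lead_mons Z"
  assume neg: "\<not> ?thesis"
  have "\<forall>A\<in>Z. \<exists>p. (\<forall>u. mcoeff p u \<noteq> 0 \<longrightarrow> mdeg u \<le> n) \<and> ev p A = 1 \<and> (\<forall>B\<in>Z - {A}. ev p B = 0)"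
  proof
    fix A assume "A \<in> Z"
    then obtain c where "fundamental n Z A c" using assms(2) by (auto simp: n_independent_def)
    then show "\<exists>p. (\<forall>u. mcoeff p u \<noteq> 0 \<longrightarrow> mdeg u \<le> n) \<and> ev p A = 1 \<and> (\<forall>B\<in>Z - {A}. ev p B = 0)"
      by (rule fundamentalE) blast
  qed
  from bchoice[OF this] obtain f where f: "\<forall>A\<in>Z. (\<forall>u. mcoeff (f A) u \<noteq> 0 \<longrightarrow> mdeg u \<le> n) \<and> ev (f A) A = 1
      \<and> (\<forall>B\<in>Z - {A}. ev (f A) B = 0)"
    by blast
  obtain G where G: "\<And>u A. u \<in> lead_mons Z \<Longrightarrow> A \<in> Z \<Longrightarrow> ev (G u) A = 0"
      "\<And>u. u \<in> lead_mons Z \<Longrightarrow> lead (G u) u"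
    using lead_mons_choice by metis
  have fin: "finite ?N" "finite ?S" using finite_mdeg_le by auto
  have "card ?N = card (?N - lead_mons Z) + card ?S"
    using fin by (subst card_Un_disjoint[symmetric]) (auto intro: arg_cong[where f = card])
  \<comment> \<open>The unknowns are indexed by the disjoint sum of nodes and leading monomials;
    there is one equation per monomial of degree at most n.\<close>
  with neg assms(1) fin have "card ?N < card (Z <+> ?S)"
    by (simp add: card_Plus)
  from underdetermined_system[OF fin(1) finite_Plus[OF assms(1) fin(2)] this, of "\<lambda>x. mcoeff (case_sum f G x)"]
  obtain a where a: "\<exists>x\<in>Z <+> ?S. a x \<noteq> 0"
      "\<And>s. s \<in> ?N \<Longrightarrow> (\<Sum>x\<in>Z <+> ?S. a x * mcoeff (case_sum f G x) s) = 0"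
    by blast
  define p where "p = (\<Sum>A\<in>Z. cst (a (Inl A)) * f A)"
  define r where "r = (\<Sum>u\<in>?S. cst (a (Inr u)) * G u)"
  have "mcoeff (p + r) s = 0" for s
  proof (cases "s \<in> ?N")
    case True
    from a(2)[OF this] show ?thesis
      using assms(1) fin by (simp add: p_def r_def sum.Plus)
  next
    case False
    then have "mcoeff (f A) s = 0" if "A \<in> Z" for A using f that by blast
    moreover have "mcoeff (G u) s = 0" if "u \<in> ?S" for u
      using lead_mdeg[of "G u" u s] G(2)[of u] that False by auto
    ultimately show ?thesis by (simp add: p_def r_def)
  qed
  then have pr: "p + r = 0" by (intro bipoly_eqI) simp
  have aZ: "a (Inl B) = 0" if "B \<in> Z" for B
  proof -
    have "ev p B = (\<Sum>A\<in>Z. if A = B then a (Inl B) else 0)"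
      unfolding p_def using f that by (auto intro!: sum.cong)
    moreover have "ev r B = 0"
      unfolding r_def using G(1) that by simp
    ultimately show ?thesis
      using arg_cong[OF pr, of "\<lambda>p. ev p B"] assms(1) that by simp
  qed
  then have "p = 0" by (simp add: p_def cst_def)
  with pr have "r = 0" by simp
  then have "a (Inr u) = 0" if "u \<in> ?S" for u
    using lead_family_independent[of ?S id G "\<lambda>u. a (Inr u)" u] fin G(2) that by (simp add: r_def)
  with aZ a(1) show False by auto
qed

text \<open>A nontrivial combination of standard monomials cannot vanish on all of Z, since its
  leading monomial would then belong to \<open>lead_mons Z\<close>.\<close>

lemma card_standard_le:
  assumes "finite Z"
  shows "card ({u. mdeg u \<le> n} - lead_mons Z) \<le> card Z"
proof (rule ccontr)
  let ?N = "{u. mdeg u \<le> n} - lead_mons Z"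
  assume "\<not> ?thesis"
  moreover have fin: "finite ?N" using finite_mdeg_le by auto
  ultimately obtain a where a: "\<exists>u\<in>?N. a u \<noteq> 0"
      "\<forall>A\<in>Z. (\<Sum>u\<in>?N. a u * ev (xymon u) A) = 0"
    using underdetermined_system[OF assms fin, of "\<lambda>u A. ev (xymon u) A"] by auto
  define p where "p = (\<Sum>u\<in>?N. cst (a u) * xymon u)"
  have "p = 0"
    using a(2) fin by (intro eq_0_if_no_lead_mons[of Z]) (auto simp: p_def if_distrib cong: if_cong)
  then have "a u = 0" if "u \<in> ?N" for u
    using lead_family_independent[of ?N id xymon a u] fin that lead_xymon by (simp add: p_def)
  with a(1) show False by blast
qed

section \<open>Dimension of the space of polynomials vanishing on the nodes\<close>

lemma finite_lead_mons_le: "finite {u\<in>lead_mons Z. mdeg u \<le> k}"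
  using finite_mdeg_le by (rule rev_finite_subset) auto

lemma curry_mcoeff_vanishing:
  "curry (mcoeff p) \<in> vanishing k X \<longleftrightarrow>
    (\<forall>u. mcoeff p u \<noteq> 0 \<longrightarrow> mdeg u \<le> k) \<and> (\<forall>A\<in>X. ev p A = 0)"
  by (simp add: vanishing_def peval_mcoeff inPi_mcoeff)

text \<open>More polynomials than elements of \<open>?S\<close> would have a nontrivial combination
  without coefficients on \<open>?S\<close>, and this combination is zero. Conversely, polynomials
  with distinct leading monomials are independent, and in a graded order a leading monomial of
  degree at most k bounds the whole degree by k.\<close>

lemma lin_indep_vanishing_iff:
  "(\<exists>P. (\<forall>l<m. P l \<in> vanishing k X) \<and> lin_indep P m) \<longleftrightarrow> m \<le> card {u\<in>lead_mons X. mdeg u \<le> k}"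
    (is "?L \<longleftrightarrow> m \<le> card ?S")
proof
  assume ?L
  then obtain P where P: "\<forall>l<m. P l \<in> vanishing k X" and ind: "lin_indep P m" by blast
  have "\<forall>l\<in>{..<m}. \<exists>p. curry (mcoeff p) = P l"
    using P unfolding vanishing_def by (metis (mono_tags, lifting) bipoly_of_inPi lessThan_iff mem_Collect_eq)
  then obtain p where p: "\<And>l. l < m \<Longrightarrow> curry (mcoeff (p l)) = P l"
    using bchoice[of "{..<m}"] by (metis lessThan_iff)
  have pv: "\<And>l u. l < m \<Longrightarrow> mcoeff (p l) u \<noteq> 0 \<Longrightarrow> mdeg u \<le> k"
    "\<And>l A. l < m \<Longrightarrow> A \<in> X \<Longrightarrow> ev (p l) A = 0"
    using P p curry_mcoeff_vanishing by metis+
  show "m \<le> card ?S"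
  proof (rule ccontr)
    assume "\<not> ?thesis"
    then obtain a where a: "\<exists>l\<in>{..<m}. a l \<noteq> 0" "\<forall>s\<in>?S. (\<Sum>l<m. a l * mcoeff (p l) s) = 0"
      using underdetermined_system[OF finite_lead_mons_le[of X k], of "{..<m}" "\<lambda>l. mcoeff (p l)"] by auto
    have p0: "(\<Sum>l<m. cst (a l) * p l) = 0"
    proof (rule eq_0_if_no_lead_mons[of X])
      fix u assume u: "u \<in> lead_mons X"
      show "mcoeff (\<Sum>l<m. cst (a l) * p l) u = 0"
      proof (cases "mdeg u \<le> k")
        case False
        then have "mcoeff (p l) u = 0" if "l < m" for l using pv(1) that by blast
        then show ?thesis by simp
      qed (use a(2) u in simp)
    qed (simp add: pv(2))
    have "(\<Sum>l<m. a l * P l i j) = (\<Sum>l<m. a l * mcoeff (p l) (i, j))" for i j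
      by (intro sum.cong) (auto simp: p[symmetric])
    then have "(\<Sum>l<m. a l * P l i j) = 0" for i j
      using arg_cong[OF p0, of "\<lambda>r. mcoeff r (i, j)"] by simp
    with ind a(1) show False by (auto simp: lin_indep_def)
  qed
next
  assume "m \<le> card ?S"
  then obtain T where T: "T \<subseteq> ?S" "card T = m" "finite T"
    by (meson finite_lead_mons_le finite_subset obtain_subset_with_card_n)
  then obtain h where h: "bij_betw h {..<m} T"
    by (metis ex_bij_betw_nat_finite lessThan_atLeast0)
  obtain G where G: "\<And>u A. u \<in> lead_mons X \<Longrightarrow> A \<in> X \<Longrightarrow> ev (G u) A = 0"
      "\<And>u. u \<in> lead_mons X \<Longrightarrow> lead (G u) u"
    using lead_mons_choice by metis
  define P where "P l = curry (mcoeff (G (h l)))" for l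
  have hS: "h l \<in> lead_mons X" "mdeg (h l) \<le> k" if "l < m" for l
    using h T(1) that by (auto simp: bij_betw_def)
  have "P l \<in> vanishing k X" if "l < m" for l
    unfolding P_def curry_mcoeff_vanishing
    using G hS[OF that] lead_mdeg order_trans by blast
  moreover have "lin_indep P m"
    unfolding lin_indep_def
  proof (intro allI impI)
    fix a :: "nat \<Rightarrow> real" and l
    assume a: "\<forall>i j. (\<Sum>l<m. a l * P l i j) = 0" and "l < m"
    have "(\<Sum>l<m. cst (a l) * G (h l)) = 0"
      using a by (intro bipoly_eqI) (auto simp: P_def)
    then show "a l = 0"
      using lead_family_independent[of "{..<m}" h "\<lambda>l. G (h l)" a l] h G(2) hS(1) \<open>l < m\<close>
      by (auto simp: bij_betw_def)
  qed
  ultimately show ?L by blast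
qed

text \<open>Reduction modulo the vanishing ideal. The polynomials f and \<open>G u\<close> are one
  more than the coordinates in S, so some nontrivial combination has no coefficient on S and is
  therefore zero; as the \<open>G u\<close> are independent, f enters it with a nonzero
  coefficient.\<close>

lemma lead_mons_spanning:
  assumes "\<And>A. A \<in> Z \<Longrightarrow> ev f A = 0" and "\<And>u. mcoeff f u \<noteq> 0 \<Longrightarrow> prod_encode u < prod_encode w"
    and S: "finite S" "{u\<in>lead_mons Z. prod_encode u < prod_encode w} = S"
    and G: "\<And>u A. u \<in> S \<Longrightarrow> A \<in> Z \<Longrightarrow> ev (G u) A = 0" "\<And>u. u \<in> S \<Longrightarrow> lead (G u) u"
  shows "\<exists>b. f = (\<Sum>u\<in>S. cst (b u) * G u)"
proof -
  \<comment> \<open>The index \<open>None\<close> stands for f and \<open>Some u\<close> for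
    \<open>G u\<close>.\<close>
  define H where "H = case_option f G"
  let ?J = "insert None (Some ` S)"
  have "card ?J = Suc (card S)"
    using S(1) by (simp add: card_image)
  with S(1) obtain a where a: "\<exists>x\<in>?J. a x \<noteq> 0" "\<forall>s\<in>S. (\<Sum>x\<in>?J. a x * mcoeff (H x) s) = 0"
    using underdetermined_system[of S ?J "\<lambda>x. mcoeff (H x)"] by auto
  have sum_J: "(\<Sum>x\<in>?J. g x) = g None + (\<Sum>u\<in>S. g (Some u))" for g :: "(nat \<times> nat) option \<Rightarrow> 'c::comm_monoid_add"
    using S(1) by (simp add: sum.reindex)
  define p where "p = cst (a None) * f + (\<Sum>u\<in>S. cst (a (Some u)) * G u)"
  have "p = 0"
  proof (rule eq_0_if_no_lead_mons[of Z])
    show "ev p A = 0" if "A \<in> Z" for A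
      using that assms(1) G(1) by (simp add: p_def)
    fix u assume u: "u \<in> lead_mons Z"
    show "mcoeff p u = 0"
    proof (cases "u \<in> S")
      case True
      with a(2) show ?thesis by (simp only: sum_J) (simp add: p_def H_def)
    next
      case False
      with u S(2) have ge: "prod_encode w \<le> prod_encode u" by auto
      have "mcoeff (G v) u = 0" if "v \<in> S" for v
        using lead_le[OF G(2)[OF that], of u] that S(2) ge by fastforce
      then show ?thesis using assms(2)[of u] ge by (fastforce simp: p_def)
    qed
  qed
  have nz: "a None \<noteq> 0"
  proof
    assume 0: "a None = 0"
    with \<open>p = 0\<close> have "(\<Sum>u\<in>S. cst (a (Some u)) * G u) = 0" by (simp add: p_def cst_def)
    then have "a (Some u) = 0" if "u \<in> S" for u
      using lead_family_independent[of S id G "\<lambda>u. a (Some u)" u] S(1) G(2) that by simp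
    with 0 a(1) show False by auto
  qed
  have "f = (\<Sum>u\<in>S. cst (- a (Some u) / a None) * G u)"
  proof (rule bipoly_eqI)
    fix u
    have "a None * mcoeff f u + (\<Sum>x\<in>S. a (Some x) * mcoeff (G x) u) = 0"
      using arg_cong[OF \<open>p = 0\<close>, of "\<lambda>p. mcoeff p u"] by (simp add: p_def)
    then have "mcoeff f u = - (\<Sum>x\<in>S. a (Some x) * mcoeff (G x) u) / a None"
      using nz by (simp add: field_simps)
    then show "mcoeff f u = mcoeff (\<Sum>u\<in>S. cst (- a (Some u) / a None) * G u) u"
      by (simp add: sum_divide_distrib sum_negf)
  qed
  then show ?thesis by (intro exI[of _ "\<lambda>u. - a (Some u) / a None"])
qed

section \<open>Growth of the leading monomials\<close>

lemma card_mdeg_eq: "card {u. mdeg u = d} = d + 1"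
proof -
  have "{u. mdeg u = d} = (\<lambda>i. (i, d - i)) ` {..d}"
    by (auto simp: mdeg_def image_iff)
  then show ?thesis by (simp add: card_image inj_on_def)
qed

lemma finite_mdeg_eq: "finite {u\<in>S. mdeg u = d}"
  by (rule finite_subset[OF _ finite_mdeg_le[of d]]) auto

lemma card_mdeg_le_sum: "card {u\<in>S. mdeg u \<le> n} = (\<Sum>d\<le>n. card {u\<in>S. mdeg u = d})"
proof (induction n)
  case (Suc n)
  have "{u\<in>S. mdeg u \<le> Suc n} = {u\<in>S. mdeg u \<le> n} \<union> {u\<in>S. mdeg u = Suc n}" by auto
  moreover have "finite {u\<in>S. mdeg u \<le> n}"
    by (rule finite_subset[OF _ finite_mdeg_le[of n]]) auto
  moreover have "{u\<in>S. mdeg u \<le> n} \<inter> {u\<in>S. mdeg u = Suc n} = {}" by auto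
  ultimately show ?case using Suc finite_mdeg_eq[of S "Suc n"] by (simp add: card_Un_disjoint)
qed simp

lemma NN_Suc: "NN (Suc n) = NN n + n + 2"
proof -
  have "(Suc n + 1) * (Suc n + 2) = (n + 1) * (n + 2) + 2 * (n + 2)" by (simp add: algebra_simps)
  then show ?thesis unfolding NN_def by simp
qed

lemma NN_sum: "NN n = (\<Sum>d\<le>n. d + 1)"
  by (induction n) (simp add: NN_def, simp add: NN_Suc)

lemma card_mdeg_le: "card {u. mdeg u \<le> n} = NN n"
  using card_mdeg_le_sum[of UNIV n] by (simp add: NN_sum card_mdeg_eq)

text \<open>Multiplication by y injects degree d into degree d + 1 and keeps x-exponents; the
  element with the largest x-exponent, multiplied by x, is one more.\<close>

lemma card_mdeg_eq_growth:
  assumes "\<And>u v. u \<in> S \<Longrightarrow> u + v \<in> S" and "card {u\<in>S. mdeg u = d} \<noteq> 0"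
  shows "card {u\<in>S. mdeg u = d} < card {u\<in>S. mdeg u = Suc d}"
proof -
  let ?D = "{u\<in>S. mdeg u = d}"
  have fin: "finite ?D" and ne: "?D \<noteq> {}"
    using assms(2) finite_mdeg_eq by auto
  then have "Max (fst ` ?D) \<in> fst ` ?D" by (intro Max_in) auto
  then obtain x where x: "x \<in> ?D" "fst x = Max (fst ` ?D)" by auto
  have max: "fst u \<le> fst x" if "u \<in> ?D" for u
    using fin that x(2) by simp
  let ?f = "\<lambda>u::nat \<times> nat. u + (0, 1)"
  have "x + (1, 0) \<notin> ?f ` ?D"
  proof
    assume "x + (1, 0) \<in> ?f ` ?D"
    then obtain u where "u \<in> ?D" "x + (1, 0) = u + (0, 1)" by blast
    with max[of u] show False by (simp add: prod_eq_iff)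
  qed
  moreover have "inj_on ?f ?D" by (auto simp: inj_on_def prod_eq_iff)
  ultimately have "card (insert (x + (1, 0)) (?f ` ?D)) = Suc (card ?D)"
    using fin by (simp add: card_image)
  moreover have sub: "insert (x + (1, 0)) (?f ` ?D) \<subseteq> {u\<in>S. mdeg u = Suc d}"
    using x(1) assms(1)[of x "(1, 0)"] assms(1)[of _ "(0, 1)"] by (simp add: image_subset_iff)
  ultimately show ?thesis
    using card_mono[OF finite_mdeg_eq sub] by linarith
qed

text \<open>Adjoining successors adds one element per maximal block of consecutive numbers, so a gap
  in T would produce a fifth element of \<open>T'\<close>.\<close>

lemma consecutive_of_card_3_4:
  fixes T T' :: "nat set"
  assumes "card T = 3" "card T' = 4" "T \<subseteq> T'" "Suc ` T \<subseteq> T'"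
  shows "\<exists>c. T = {c, c + 1, c + 2} \<and> T' = {c, c + 1, c + 2, c + 3}"
proof -
  have fin: "finite T'" using assms(2) by (metis card.infinite zero_neq_numeral)
  define xs where "xs = sorted_list_of_set T"
  have xs: "set xs = T" "length xs = 3" "sorted_wrt (<) xs"
    using assms(1,3) finite_subset[OF assms(3) fin] by (simp_all add: xs_def)
  then obtain x y z where "xs = [x, y, z]"
    by (auto simp: numeral_3_eq_3 length_Suc_conv)
  with xs have T: "T = {x, y, z}" "x < y" "y < z" by auto
  have sub: "{x, y, z, x + 1, y + 1, z + 1} \<subseteq> T'" using assms(3,4) T(1) by auto
  have "y = x + 1"
  proof (rule ccontr)
    assume "y \<noteq> x + 1"
    then have "card {x, x + 1, y, z, z + 1} = 5" using T by simp
    moreover have "card {x, x + 1, y, z, z + 1} \<le> card T'"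
      using sub by (intro card_mono fin) auto
    ultimately show False using assms(2) by simp
  qed
  moreover have "z = y + 1"
  proof (rule ccontr)
    assume "z \<noteq> y + 1"
    then have "card {x, y, y + 1, z, z + 1} = 5" using T by simp
    moreover have "card {x, y, y + 1, z, z + 1} \<le> card T'"
      using sub by (intro card_mono fin) auto
    ultimately show False using assms(2) by simp
  qed
  ultimately have T': "T = {x, x + 1, x + 2}" "{x, x + 1, x + 2, x + 3} \<subseteq> T'"
    using T sub by (auto simp: numeral_3_eq_3)
  have "{x, x + 1, x + 2, x + 3} = T'"
    using T'(2) assms(2) by (intro card_subset_eq fin) auto
  with T' show ?thesis by blast
qed

text \<open>Within one degree a monomial is determined by its x-exponent; multiplication by y keeps
  this exponent and multiplication by x raises it by one.\<close>

lemma consecutive_mons_of_card_3_4: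
  assumes add: "\<And>u v. u \<in> S \<Longrightarrow> u + v \<in> S"
    and card: "card {u\<in>S. mdeg u = k} = 3" "card {u\<in>S. mdeg u = Suc k} = 4"
  obtains c b where "c + b + 2 = k" "{u\<in>S. mdeg u = k} = {(c, b + 2), (c + 1, b + 1), (c + 2, b)}"
    "{u\<in>S. mdeg u = Suc k} = {(c, b + 3), (c + 1, b + 2), (c + 2, b + 1), (c + 3, b)}"
proof -
  let ?D = "\<lambda>d. {u\<in>S. mdeg u = d}"
  have D: "?D d = (\<lambda>i. (i, d - i)) ` fst ` ?D d" for d
    by (force simp: image_image mdeg_def)
  have inj: "inj_on fst (?D d)" for d
    by (auto simp: inj_on_def mdeg_def prod_eq_iff)
  have "fst ` ?D k \<subseteq> fst ` ?D (Suc k)"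
  proof
    fix i assume "i \<in> fst ` ?D k"
    then obtain u where "u \<in> ?D k" "i = fst u" by blast
    then have "u + (0, 1) \<in> ?D (Suc k)" "fst (u + (0, 1)) = i" using add by auto
    then show "i \<in> fst ` ?D (Suc k)" by (metis image_eqI)
  qed
  moreover have "Suc ` fst ` ?D k \<subseteq> fst ` ?D (Suc k)"
  proof
    fix i assume "i \<in> Suc ` fst ` ?D k"
    then obtain u where "u \<in> ?D k" "i = Suc (fst u)" by blast
    then have "u + (1, 0) \<in> ?D (Suc k)" "fst (u + (1, 0)) = i" using add by auto
    then show "i \<in> fst ` ?D (Suc k)" by (metis image_eqI)
  qed
  ultimately obtain c where c: "fst ` ?D k = {c, c + 1, c + 2}"
      "fst ` ?D (Suc k) = {c, c + 1, c + 2, c + 3}"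
    using consecutive_of_card_3_4[of "fst ` ?D k" "fst ` ?D (Suc k)"] card
    by (auto simp: card_image[OF inj])
  have "c + 2 \<in> fst ` ?D k" using c by simp
  then have "c + 2 \<le> k" by (auto simp: mdeg_def)
  then obtain b where b: "k = c + b + 2" by (metis add.commute add.left_commute le_iff_add)
  have "?D k = (\<lambda>i. (i, k - i)) ` {c, c + 1, c + 2}"
    unfolding c(1)[symmetric] by (rule D)
  then have "?D k = {(c, b + 2), (c + 1, b + 1), (c + 2, b)}"
    by (simp only: image_insert image_empty) (simp add: b add.commute)
  moreover have "?D (Suc k) = (\<lambda>i. (i, Suc k - i)) ` {c, c + 1, c + 2, c + 3}"
    unfolding c(2)[symmetric] by (rule D)
  then have "?D (Suc k) = {(c, b + 3), (c + 1, b + 2), (c + 2, b + 1), (c + 3, b)}"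
    by (simp only: image_insert image_empty) (simp add: b add.commute)
  ultimately show thesis using that[of c b] b by simp
qed

text \<open>Write n = k + m. The hypothesis bounds the sum of \<open>e\<close> up to n by 3 + 4 +
  ... + (m + 3), while strict growth gives \<open>e k + t \<le> e (k + t)\<close> if
  \<open>e k \<noteq> 0\<close>. So \<open>e k > 3\<close> is impossible, and \<open>e k = 3\<close>
  already uses up the whole bound from degree k on.\<close>

lemma growth_bound:
  fixes e :: "nat \<Rightarrow> nat"
  assumes grow: "\<And>d. e d \<noteq> 0 \<Longrightarrow> e d < e (Suc d)" and "0 < k" "k < n"
    and sum: "(\<Sum>d\<le>n. e d) + 3 \<le> NN (n - k + 2)"
  shows "(\<Sum>d\<le>k. e d) \<le> 3"
    and "(\<Sum>d\<le>k. e d) = 3 \<Longrightarrow> (\<exists>d<k. e d \<noteq> 0) \<or> e k = 3 \<and> e (Suc k) = 4"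
proof -
  have grow': "e d + t \<le> e (d + t)" if "e d \<noteq> 0" for d t
  proof (induction t)
    case (Suc t)
    with that grow[of "d + t"] show ?case by simp
  qed simp
  obtain m where n: "n = k + m" "0 < m" using \<open>k < n\<close> less_imp_add_positive by blast
  have NN': "NN (m + 2) = 3 + (\<Sum>t\<le>m. t + 3)"
    by (induction m) (simp_all add: NN_Suc, simp add: NN_def)
  have split: "(\<Sum>d\<le>k + m. e d) = (\<Sum>d<k. e d) + (\<Sum>t\<le>m. e (k + t))"
    by (induction m) (simp_all add: lessThan_Suc_atMost[symmetric])
  have le: "(\<Sum>d<k. e d) + (\<Sum>t\<le>m. e (k + t)) \<le> (\<Sum>t\<le>m. t + 3)"
    using sum NN' split n(1) by simp
  have ek: "e k \<le> 3"
  proof (rule ccontr)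
    assume "\<not> e k \<le> 3"
    then have "t + 3 < e (k + t)" for t using grow'[of k t] by simp
    then have "(\<Sum>t\<le>m. t + 3) < (\<Sum>t\<le>m. e (k + t))" by (intro sum_strict_mono) auto
    with le show False by simp
  qed
  have sumk: "(\<Sum>d\<le>k. e d) = (\<Sum>d<k. e d) + e k"
    by (simp add: lessThan_Suc_atMost[symmetric])
  show "(\<Sum>d\<le>k. e d) \<le> 3"
  proof (cases "e k = 3")
    case True
    then have "t + 3 \<le> e (k + t)" for t using grow'[of k t] by simp
    then have "(\<Sum>t\<le>m. t + 3) \<le> (\<Sum>t\<le>m. e (k + t))" by (intro sum_mono) auto
    with le sumk True show ?thesis by linarith
  next
    case False
    with ek have ek2: "e k \<le> 2" by simp
    obtain j where j: "k = Suc j" using \<open>0 < k\<close> gr0_conv_Suc by auto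
    \<comment> \<open>A nonzero value at least two degrees below k would have grown to at least 3 at
      k.\<close>
    have "e d = 0" if "d < j" for d
      using grow'[of d "k - d"] that ek2 j by fastforce
    then have "(\<Sum>d<k. e d) = e j" by (simp add: j)
    moreover have "e j \<le> 1" using grow[of j] ek2 j by fastforce
    ultimately show ?thesis using sumk ek2 by simp
  qed
  assume sum3: "(\<Sum>d\<le>k. e d) = 3"
  show "(\<exists>d<k. e d \<noteq> 0) \<or> e k = 3 \<and> e (Suc k) = 4"
  proof (cases "\<exists>d<k. e d \<noteq> 0")
    case False
    then have ek3: "e k = 3" using sumk sum3 by simp
    then have ge: "t + 3 \<le> e (k + t)" for t using grow'[of k t] by simp
    have "e (Suc k) = 4"
    proof (rule ccontr)
      assume "e (Suc k) \<noteq> 4"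
      \<comment> \<open>The bound leaves no slack, so an excess at t = 1 contradicts it; this index
        is in range because m > 0.\<close>
      then have "1 + 3 < e (k + 1)" using ge[of 1] by simp
      then have "(\<Sum>t\<le>m. t + 3) < (\<Sum>t\<le>m. e (k + t))"
        using ge n(2) by (intro sum_strict_mono_ex1) (auto intro!: bexI[of _ 1])
      with le show False by simp
    qed
    with ek3 show ?thesis by simp
  qed blast
qed

section \<open>Splitting off a common factor\<close>

text \<open>The leading monomials x^2 of m0 and y^2 of m2 are coprime, so the relation forces y^2 to
  divide the leading monomial of p2. Subtracting s m2 from p2 and s m0 from p0 preserves the
  relation, so division of p2 by m2 continues down to remainder zero.\<close>

lemma lead_quotient:
  assumes m0: "lead m0 (2, 0)" and m2: "lead m2 (0, 2)" and "p0 * m2 = p2 * m0"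
  shows "\<exists>q. p2 = q * m2"
proof -
  have "\<exists>q. p2 = q * m2"
    if "\<And>u. mcoeff p2 u \<noteq> 0 \<Longrightarrow> prod_encode u < N" "p0 * m2 = p2 * m0" for N p0 p2
    using that
  proof (induction N arbitrary: p0 p2)
    case 0
    then have "p2 = 0 * m2" by (intro bipoly_eqI) auto
    then show ?case by blast
  next
    case (Suc N)
    \<comment> \<open>The only exponent pair with code N, hence the highest one that p2 can
      contain.\<close>
    define w where "w = prod_decode N"
    have less: "prod_encode u < N" if "prod_encode u < Suc N" "u \<noteq> w" for u
      using that by (metis less_SucE prod_encode_inverse w_def)
    show ?case
    proof (cases "mcoeff p2 w = 0")
      case True
      with Suc.prems less show ?thesis by (intro Suc.IH[of p2 p0]) metis+
    next
      case False
      have lp2: "lead p2 w"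
        unfolding lead_def using False Suc.prems(1) by (auto simp: w_def less_Suc_eq_le)
      then have "p2 * m0 \<noteq> 0" using m0 by (auto simp: lead_def)
      then have "p0 \<noteq> 0" using Suc.prems(2) by auto
      then obtain v where "lead p0 v" by (rule lead_exists)
      from lead_mult(1)[OF this m2] lead_mult(1)[OF lp2 m0] Suc.prems(2)
      have "v + (0, 2) = w + (2, 0)" by (metis lead_unique)
      then have w: "w = (fst w, snd v) + (0, 2)" by (simp add: prod_eq_iff)
      define i j where "i = fst w" and "j = snd v"
      note w = w[folded i_def j_def]
      \<comment> \<open>Chosen so that \<open>s * m2\<close> has the same leading term as
        p2.\<close>
      define s where "s = cst (mcoeff p2 w / mcoeff m2 (0, 2)) * xymon (i, j)"
      have sm: "s * m2 = cst (mcoeff p2 w / mcoeff m2 (0, 2)) * (xymon (i, j) * m2)"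
        by (simp add: s_def mult.assoc)
      note lx = lead_mult[OF lead_xymon m2, of "(i, j)", folded w]
      have "prod_encode u < N" if u: "mcoeff (p2 - s * m2) u \<noteq> 0" for u
      proof (rule less)
        have "mcoeff p2 u \<noteq> 0 \<or> mcoeff (xymon (i, j) * m2) u \<noteq> 0" using u by (auto simp: sm)
        then have "prod_encode u \<le> prod_encode w" using lead_le[OF lp2] lead_le[OF lx(1)] by blast
        then show "prod_encode u < Suc N" by (simp add: w_def)
        show "u \<noteq> w"
          using u lx(2) lead_nonzero[OF m2] by (auto simp: sm)
      qed
      moreover have "(p0 - s * m0) * m2 = (p2 - s * m2) * m0"
        using Suc.prems(2) by (simp add: algebra_simps)
      ultimately obtain q where "p2 - s * m2 = q * m2" using Suc.IH by blast
      then have "p2 = (q + s) * m2" by (simp add: algebra_simps)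
      then show ?thesis by blast
    qed
  qed
  moreover have "\<exists>N. \<forall>u. mcoeff p2 u \<noteq> 0 \<longrightarrow> prod_encode u < N"
  proof (cases "p2 = 0")
    case False
    then show ?thesis by (metis lead_exists lead_le less_Suc_eq_le)
  qed simp
  ultimately show ?thesis using assms(3) by blast
qed

lemma lead_mons_monic:
  assumes "u \<in> lead_mons Z"
  obtains p where "\<And>A. A \<in> Z \<Longrightarrow> ev p A = 0" "lead p u" "mcoeff p u = 1"
proof -
  from assms obtain p where p: "\<forall>A\<in>Z. ev p A = 0" "lead p u" unfolding lead_mons_def by blast
  let ?p = "cst (1 / mcoeff p u) * p"
  show thesis
  proof (rule that)
    show "lead ?p u" unfolding lead_def using lead_nonzero[OF p(2)] lead_le[OF p(2)] by simp
  qed (use p lead_nonzero[OF p(2)] in auto)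
qed

text \<open>Meant for the S-polynomials \<open>y * p0 - x * p1\<close> and
  \<open>y * p1 - x * p2\<close> below: when leading terms cancel, only smaller monomials
  remain.\<close>

lemma lead_cancel:
  assumes "lead p u" "lead q u" "mcoeff p u = mcoeff q u" "mcoeff (p - q) v \<noteq> 0"
  shows "prod_encode v < prod_encode u"
proof -
  from assms(4) have "mcoeff p v \<noteq> 0 \<or> mcoeff q v \<noteq> 0" by auto
  then have "prod_encode v \<le> prod_encode u" using lead_le assms(1,2) by blast
  moreover have "v \<noteq> u" using assms(3,4) by auto
  ultimately show ?thesis by (simp add: prod_encode_eq le_less)
qed

section \<open>Constants, monomials and explicit quadrics\<close>

lemma cst_add: "cst (a + b) = cst a + cst b"
  and cst_mult: "cst (a * b) = cst a * cst b"
  and cst_uminus: "cst (- a) = - cst a"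
  by (simp_all add: cst_def)

lemma xymon_add: "xymon (u + v) = xymon u * xymon v"
  by (simp add: xymon_def mult_monom)

lemma xymon_0: "xymon (0, 0) = 1"
  by (simp add: xymon_def)

lemma xymon_degree_2:
  "xymon (2, 0) = xymon (1, 0) * xymon (1, 0)"
  "xymon (1, 1) = xymon (1, 0) * xymon (0, 1)"
  "xymon (0, 2) = xymon (0, 1) * xymon (0, 1)"
  by (simp_all add: xymon_add[symmetric] flip: One_nat_def)

lemma lead_add_lower:
  assumes "lead p u" "prod_encode w < prod_encode u"
  shows "lead (p + cst a * xymon w) u"
  unfolding lead_def
proof (intro conjI allI impI)
  show "mcoeff (p + cst a * xymon w) u \<noteq> 0"
    using assms lead_nonzero by auto
  fix v assume "mcoeff (p + cst a * xymon w) v \<noteq> 0"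
  then have "mcoeff p v \<noteq> 0 \<or> v = w" by (auto split: if_splits)
  then show "prod_encode v \<le> prod_encode u"
    using lead_le[OF assms(1)] assms(2) less_imp_le by blast
qed

text \<open>The summands stand in decreasing order, so the first one leads. These are the shapes of
  \<open>m0\<close>, \<open>m1\<close>, \<open>m2\<close> in
  \<open>common_factor_of_consecutive\<close>.\<close>

lemma lead_degree_2:
  "lead (xymon (2, 0) + cst a * xymon (1, 1) + cst b * xymon (0, 2)
    + cst c * xymon (1, 0) + cst d * xymon (0, 1) + cst e * xymon (0, 0)) (2, 0)"
  "lead (xymon (1, 1) + cst b * xymon (0, 2)
    + cst c * xymon (1, 0) + cst d * xymon (0, 1) + cst e * xymon (0, 0)) (1, 1)"
  "lead (xymon (0, 2) + cst c * xymon (1, 0) + cst d * xymon (0, 1) + cst e * xymon (0, 0)) (0, 2)"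
  by (intro lead_add_lower lead_xymon; simp add: prod_encode_less_iff)+

text \<open>Davis' theorem in the case needed here. The two linear relations between the three
  generators of degree \<open>k\<close> form a \<open>2 \<times> 3\<close> matrix, and as in the Hilbert--Burch theorem
  the generators are a common multiple \<open>q\<close> of its maximal minors \<open>m0, m1, m2\<close>.\<close>

lemma common_factor_of_consecutive:
  assumes low: "\<And>u. u \<in> lead_mons Z \<Longrightarrow> c + b + 2 \<le> mdeg u"
    and deg: "{u\<in>lead_mons Z. mdeg u = c + b + 2} = {(c, b + 2), (c + 1, b + 1), (c + 2, b)}"
    and deg': "{u\<in>lead_mons Z. mdeg u = c + b + 3}
      = {(c, b + 3), (c + 1, b + 2), (c + 2, b + 1), (c + 3, b)}"
  obtains q m0 m1 m2 where "lead q (c, b)" "lead m0 (2, 0)" "lead m1 (1, 1)" "lead m2 (0, 2)"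
    "\<forall>A\<in>Z. ev q A \<noteq> 0 \<longrightarrow> ev m0 A = 0 \<and> ev m1 A = 0 \<and> ev m2 A = 0"
proof -
  have gens: "(c + 2, b) \<in> lead_mons Z" "(c + 1, b + 1) \<in> lead_mons Z" "(c, b + 2) \<in> lead_mons Z"
    using deg by blast+
  obtain p0 where
    p0: "\<And>A. A \<in> Z \<Longrightarrow> ev p0 A = 0" "lead p0 (c + 2, b)" "mcoeff p0 (c + 2, b) = 1"
    by (rule lead_mons_monic[OF gens(1)]) blast
  obtain p1 where
    p1: "\<And>A. A \<in> Z \<Longrightarrow> ev p1 A = 0" "lead p1 (c + 1, b + 1)" "mcoeff p1 (c + 1, b + 1) = 1"
    by (rule lead_mons_monic[OF gens(2)]) blast
  obtain p2 where
    p2: "\<And>A. A \<in> Z \<Longrightarrow> ev p2 A = 0" "lead p2 (c, b + 2)" "mcoeff p2 (c, b + 2) = 1"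
    by (rule lead_mons_monic[OF gens(3)]) blast
  define x y where "x = xymon (1, 0)" and "y = xymon (0, 1)"
  have lx: "lead (x * p) (i + 1, j)" "mcoeff (x * p) (i + 1, j) = mcoeff p (i, j)"
    and ly: "lead (y * p) (i, j + 1)" "mcoeff (y * p) (i, j + 1) = mcoeff p (i, j)"
    if "lead p (i, j)" for p i j
    using lead_mult[OF lead_xymon that, of "(1, 0)"] lead_mult[OF lead_xymon that, of "(0, 1)"]
    unfolding x_def y_def by simp_all
  \<comment> \<open>The two monomials of degree c + b + 3 below (c + 2, b + 1) are realised by
    multiples of p2, so the reductions become relations among the three generators with coefficients
    of degree at most 1.\<close>
  define G where "G u = (if u = (c + 2, b) then p0 else if u = (c + 1, b + 1) then p1
    else if u = (c, b + 2) then p2 else if u = (c + 1, b + 2) then x * p2 else y * p2)" for u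
  have GZ: "ev (G u) A = 0" if "A \<in> Z" for u A
    using that p0(1) p1(1) p2(1) by (simp add: G_def)
  have G: "lead (G u) u" if "u \<in> {(c + 1, b + 2), (c, b + 3), (c + 2, b), (c + 1, b + 1), (c, b + 2)}" for u
    using that p0(2) p1(2) p2(2) lx(1)[OF p2(2)] ly(1)[OF p2(2)] by (auto simp: G_def numeral_3_eq_3)
  have mdeg_cases: "u \<in> {(c, b + 2), (c + 1, b + 1), (c + 2, b)}
      \<or> u \<in> {(c, b + 3), (c + 1, b + 2), (c + 2, b + 1), (c + 3, b)}"
    if "u \<in> lead_mons Z" "mdeg u \<le> c + b + 3" for u
    unfolding deg[symmetric] deg'[symmetric] using low[OF that(1)] that by auto
  have in_lead: "u \<in> lead_mons Z" if "u \<in> {(c, b + 2), (c + 1, b + 1), (c + 2, b)}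
      \<or> u \<in> {(c, b + 3), (c + 1, b + 2), (c + 2, b + 1), (c + 3, b)}" for u
    using that unfolding deg[symmetric] deg'[symmetric] by blast
  \<comment> \<open>The bound (c + 2, b + 1) is the common leading monomial of \<open>y * p0\<close>
    and \<open>x * p1\<close>; the bound (c + 1, b + 2) in \<open>S2\<close> is that of
    \<open>y * p1\<close> and \<open>x * p2\<close>.\<close>
  have S1: "{u\<in>lead_mons Z. prod_encode u < prod_encode (c + 2, b + 1)}
      = {(c + 1, b + 2), (c, b + 3), (c + 2, b), (c + 1, b + 1), (c, b + 2)}"
  proof (intro equalityI subsetI)
    fix u assume "u \<in> {u\<in>lead_mons Z. prod_encode u < prod_encode (c + 2, b + 1)}"
    then show "u \<in> {(c + 1, b + 2), (c, b + 3), (c + 2, b), (c + 1, b + 1), (c, b + 2)}"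
      using mdeg_cases[of u] by (auto simp: prod_encode_less_iff)
  next
    fix u assume "u \<in> {(c + 1, b + 2), (c, b + 3), (c + 2, b), (c + 1, b + 1), (c, b + 2)}"
    then show "u \<in> {u\<in>lead_mons Z. prod_encode u < prod_encode (c + 2, b + 1)}"
      using in_lead[of u] by (auto simp: prod_encode_less_iff)
  qed
  have S2: "{u\<in>lead_mons Z. prod_encode u < prod_encode (c + 1, b + 2)}
      = {(c, b + 3), (c + 2, b), (c + 1, b + 1), (c, b + 2)}"
  proof (intro equalityI subsetI)
    fix u assume "u \<in> {u\<in>lead_mons Z. prod_encode u < prod_encode (c + 1, b + 2)}"
    then show "u \<in> {(c, b + 3), (c + 2, b), (c + 1, b + 1), (c, b + 2)}"
      using mdeg_cases[of u] by (auto simp: prod_encode_less_iff)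
  next
    fix u assume "u \<in> {(c, b + 3), (c + 2, b), (c + 1, b + 1), (c, b + 2)}"
    then show "u \<in> {u\<in>lead_mons Z. prod_encode u < prod_encode (c + 1, b + 2)}"
      using in_lead[of u] by (auto simp: prod_encode_less_iff)
  qed
  have "\<exists>\<beta>. y * p0 - x * p1 = (\<Sum>u\<in>{(c + 1, b + 2), (c, b + 3), (c + 2, b), (c + 1, b + 1), (c, b + 2)}.
      cst (\<beta> u) * G u)"
  proof (rule lead_mons_spanning[OF _ _ _ S1])
    fix u assume "mcoeff (y * p0 - x * p1) u \<noteq> 0"
    then show "prod_encode u < prod_encode (c + 2, b + 1)"
      using lead_cancel[of "y * p0" "(c + 2, b + 1)" "x * p1" u] ly[OF p0(2)] lx[OF p1(2)] p0(3) p1(3)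
      by simp
  qed (use GZ G p0(1) p1(1) in simp_all)
  then obtain \<beta> where "y * p0 - x * p1 = (\<Sum>u\<in>{(c + 1, b + 2), (c, b + 3), (c + 2, b), (c + 1, b + 1), (c, b + 2)}.
      cst (\<beta> u) * G u)" ..
  then obtain a1 a2 a3 a4 a5 where
    rel1: "y * p0 - x * p1 = cst a1 * (x * p2) + cst a2 * (y * p2) + cst a3 * p0 + cst a4 * p1 + cst a5 * p2"
    by (simp add: G_def algebra_simps)
  have "\<exists>\<beta>. y * p1 - x * p2 = (\<Sum>u\<in>{(c, b + 3), (c + 2, b), (c + 1, b + 1), (c, b + 2)}.
      cst (\<beta> u) * G u)"
  proof (rule lead_mons_spanning[OF _ _ _ S2])
    fix u assume "mcoeff (y * p1 - x * p2) u \<noteq> 0"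
    then show "prod_encode u < prod_encode (c + 1, b + 2)"
      using lead_cancel[of "y * p1" "(c + 1, b + 2)" "x * p2" u] ly[OF p1(2)] lx[OF p2(2)] p1(3) p2(3)
      by simp
  qed (use GZ G p1(1) p2(1) in simp_all)
  then obtain \<beta>' where "y * p1 - x * p2 = (\<Sum>u\<in>{(c, b + 3), (c + 2, b), (c + 1, b + 1), (c, b + 2)}.
      cst (\<beta>' u) * G u)" ..
  then obtain b2 b3 b4 b5 where
    rel2: "y * p1 - x * p2 = cst b2 * (y * p2) + cst b3 * p0 + cst b4 * p1 + cst b5 * p2"
    by (simp add: G_def algebra_simps)
  \<comment> \<open>The matrix with rows (y - a3, -(x + a4), -W) and (-b3, y - b4, -V) annihilates
    (p0, p1, p2), and \<open>m0\<close>, \<open>m1\<close>, \<open>m2\<close> are its 2 x 2 minors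
    up to sign. In \<open>V\<close> the variable x has coefficient 1, which gives \<open>m0\<close>
    the leading term x^2.\<close>
  define W where "W = cst a1 * x + cst a2 * y + cst a5"
  define V where "V = x + cst b2 * y + cst b5"
  define m0 where "m0 = (x + cst a4) * V + W * (y - cst b4)"
  define m1 where "m1 = cst b3 * W + (y - cst a3) * V"
  define m2 where "m2 = (y - cst a3) * (y - cst b4) - cst b3 * (x + cst a4)"
  have r1: "(y - cst a3) * p0 = (x + cst a4) * p1 + W * p2"
    using rel1 by (simp add: W_def algebra_simps)
  have r2: "(y - cst b4) * p1 = cst b3 * p0 + V * p2"
    using rel2 by (simp add: V_def algebra_simps)
  \<comment> \<open>Cramer's rule: eliminating p1 from \<open>r1\<close> and \<open>r2\<close> gives
    \<open>e0\<close>, eliminating p0 gives \<open>e1\<close>.\<close>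
  have e0: "p0 * m2 = p2 * m0"
    using r1 r2 unfolding m0_def m2_def by algebra
  have e1: "p1 * m2 = p2 * m1"
    using r1 r2 unfolding m1_def m2_def by algebra
  have "m0 = xymon (2, 0) + cst (b2 + a1) * xymon (1, 1) + cst a2 * xymon (0, 2)
      + cst (b5 + a4 + - (a1 * b4)) * xymon (1, 0) + cst (a4 * b2 + a5 + - (a2 * b4)) * xymon (0, 1)
      + cst (a4 * b5 + - (a5 * b4)) * xymon (0, 0)"
    unfolding m0_def W_def V_def xymon_degree_2 xymon_0 x_def[symmetric] y_def[symmetric]
      cst_add cst_mult cst_uminus by algebra
  then have lm0: "lead m0 (2, 0)" using lead_degree_2(1) by simp
  have "m1 = xymon (1, 1) + cst b2 * xymon (0, 2) + cst (b3 * a1 + - a3) * xymon (1, 0)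
      + cst (b3 * a2 + b5 + - (a3 * b2)) * xymon (0, 1) + cst (b3 * a5 + - (a3 * b5)) * xymon (0, 0)"
    unfolding m1_def W_def V_def xymon_degree_2 xymon_0 x_def[symmetric] y_def[symmetric]
      cst_add cst_mult cst_uminus by algebra
  then have lm1: "lead m1 (1, 1)" using lead_degree_2(2) by simp
  have "m2 = xymon (0, 2) + cst (- b3) * xymon (1, 0) + cst (- a3 + - b4) * xymon (0, 1)
      + cst (a3 * b4 + - (b3 * a4)) * xymon (0, 0)"
    unfolding m2_def xymon_degree_2 xymon_0 x_def[symmetric] y_def[symmetric]
      cst_add cst_mult cst_uminus by algebra
  then have lm2: "lead m2 (0, 2)" using lead_degree_2(3) by simp
  obtain q where q: "p2 = q * m2" using lead_quotient[OF lm0 lm2 e0] by blast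
  have "m2 \<noteq> 0" using lm2 by (auto simp: lead_def)
  have "p0 * m2 = (q * m0) * m2" "p1 * m2 = (q * m1) * m2"
    using e0 e1 unfolding q by (simp_all add: ac_simps)
  with \<open>m2 \<noteq> 0\<close> have q01: "p0 = q * m0" "p1 = q * m1" by simp_all
  have "q \<noteq> 0" using q p2(3) by auto
  then obtain v where v: "lead q v" by (rule lead_exists)
  have "v + (0, 2) = (c, b + 2)"
    using lead_mult(1)[OF v lm2] p2(2) unfolding q[symmetric] by (rule lead_unique)
  then have "v = (c, b)" by (simp add: prod_eq_iff)
  show thesis
  proof (rule that)
    show "lead q (c, b)" using v \<open>v = (c, b)\<close> by simp
    show "\<forall>A\<in>Z. ev q A \<noteq> 0 \<longrightarrow> ev m0 A = 0 \<and> ev m1 A = 0 \<and> ev m2 A = 0"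
    proof (intro ballI impI)
      fix A assume "A \<in> Z" "ev q A \<noteq> 0"
      then show "ev m0 A = 0 \<and> ev m1 A = 0 \<and> ev m2 A = 0"
        using p0(1)[of A] p1(1)[of A] p2(1)[of A] unfolding q q01 by simp
    qed
  qed (fact lm0 lm1 lm2)+
qed

section \<open>Curves through independent nodes\<close>

lemma n_independent_subset: "n_independent n X \<Longrightarrow> Y \<subseteq> X \<Longrightarrow> n_independent n Y"
  unfolding n_independent_def fundamental_def by (metis Diff_iff subsetD)

lemma lead_has_degree: "lead q u \<Longrightarrow> has_degree (curry (mcoeff q)) (mdeg u)"
  unfolding has_degree_def inPi_mcoeff curry_conv mdeg_def[of u]
  using lead_mdeg[of q u] lead_nonzero[of q u] by (metis mdeg_def prod.collapse)

lemma has_degree_lead: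
  assumes "has_degree c m"
  obtains q u where "curry (mcoeff q) = c" "lead q u" "mdeg u = m"
proof -
  from assms obtain i j where c: "inPi m c" "i + j = m" "c i j \<noteq> 0" by (auto simp: has_degree_def)
  obtain q where q: "curry (mcoeff q) = c" using bipoly_of_inPi[OF c(1)] .
  then have nz: "mcoeff q (i, j) \<noteq> 0" using c(3) by auto
  then have "q \<noteq> 0" by auto
  then obtain u where u: "lead q u" by (rule lead_exists)
  have "mdeg u \<le> m" using c(1) lead_nonzero[OF u] unfolding q[symmetric] inPi_mcoeff by blast
  moreover have "m \<le> mdeg u" using lead_mdeg[OF u nz] c(2) by simp
  ultimately show thesis using that q u by simp
qed

text \<open>All multiples of u belong to \<open>lead_mons Y\<close>. Those of degree at most n
  number \<open>NN (n - mdeg u)\<close>, which leaves at most \<open>dd n (mdeg u)\<close> standard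
  monomials.\<close>

lemma curve_card_le:
  assumes "finite Y" "n_independent n Y" "lead q u" "mdeg u \<le> n" "\<And>A. A \<in> Y \<Longrightarrow> ev q A = 0"
  shows "card Y \<le> dd n (mdeg u)"
proof -
  let ?N = "{u. mdeg u \<le> n}"
  have u: "u \<in> lead_mons Y" using assms(3,5) unfolding lead_mons_def by blast
  let ?M = "(+) u ` {v. mdeg v \<le> n - mdeg u}"
  have "card ?M = NN (n - mdeg u)"
    by (simp add: card_image card_mdeg_le)
  moreover have "?M \<subseteq> ?N" using assms(4) by auto
  ultimately have "card (?N - ?M) = dd n (mdeg u)"
    using finite_mdeg_le by (simp add: card_Diff_subset dd_def card_mdeg_le)
  moreover have "?N - lead_mons Y \<subseteq> ?N - ?M" using lead_mons_add[OF u] by blast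
  ultimately have "card (?N - lead_mons Y) \<le> dd n (mdeg u)"
    using finite_mdeg_le by (metis card_mono finite_Diff)
  with card_n_independent_le[OF assms(1,2)] show ?thesis by simp
qed

theorem mainTheorem2:
  fixes n k :: nat and X :: "point set"
  assumes "3 \<le> k" and "k + 2 \<le> n"
    and "finite X" and "n_independent n X"
    and "card X = dd n (k - 2) + 3"
  shows "(\<forall>m P. (\<forall>l<m. P l \<in> vanishing k X) \<and> lin_indep P m \<longrightarrow> m \<le> 3)
       \<and> ((\<exists>P. (\<forall>l<3. P l \<in> vanishing k X) \<and> lin_indep P 3) \<longleftrightarrow>
            ((\<exists>q. has_degree q (k - 1) \<and> (\<forall>A\<in>X. peval q A = 0))
             \<or> (\<exists>q. has_degree q (k - 2) \<and> card {A\<in>X. peval q A \<noteq> 0} = 3)))"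
proof -
  define e where "e d = card {u\<in>lead_mons X. mdeg u = d}" for d
  let ?S = "{u\<in>lead_mons X. mdeg u \<le> k}"
  have card_S: "card ?S = (\<Sum>d\<le>k. e d)" by (simp add: card_mdeg_le_sum e_def)
  have grow: "e d < e (Suc d)" if "e d \<noteq> 0" for d
    using card_mdeg_eq_growth[of "lead_mons X" d] lead_mons_add that by (simp add: e_def)
  have "card {u. mdeg u \<le> n} = card ({u. mdeg u \<le> n} - lead_mons X) + card {u\<in>lead_mons X. mdeg u \<le> n}"
    using finite_mdeg_le finite_lead_mons_le
    by (subst card_Un_disjoint[symmetric]) (auto intro: arg_cong[where f = card])
  then have "NN n = card ({u. mdeg u \<le> n} - lead_mons X) + (\<Sum>d\<le>n. e d)"
    by (simp add: card_mdeg_le card_mdeg_le_sum e_def)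
  \<comment> \<open>Independence bounds the nodes by the standard monomials of degree at most n;
    since \<open>dd n (k - 2)\<close> is \<open>NN n - NN (n - k + 2)\<close>, this turns into the
    summation hypothesis of \<open>growth_bound\<close>.\<close>
  then have "dd n (k - 2) + 3 + (\<Sum>d\<le>n. e d) \<le> NN n"
    using card_n_independent_le[OF assms(3,4)] assms(5) by simp
  moreover have "n - (k - 2) = n - k + 2" using assms(1,2) by simp
  ultimately have sum: "(\<Sum>d\<le>n. e d) + 3 \<le> NN (n - k + 2)"
    by (simp add: dd_def)
  note bound = growth_bound[OF grow _ _ sum]
  have "card ?S \<le> 3" using bound(1) assms(1,2) card_S by simp
  then have at_most: "\<forall>m P. (\<forall>l<m. P l \<in> vanishing k X) \<and> lin_indep P m \<longrightarrow> m \<le> 3"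
    using lin_indep_vanishing_iff[of _ k X] by (meson order_trans)
  have "card ?S = 3 \<longleftrightarrow> (\<exists>q. has_degree q (k - 1) \<and> (\<forall>A\<in>X. peval q A = 0))
      \<or> (\<exists>q. has_degree q (k - 2) \<and> card {A\<in>X. peval q A \<noteq> 0} = 3)" (is "_ \<longleftrightarrow> ?A \<or> ?B")
  proof
    assume "card ?S = 3"
    \<comment> \<open>A leading monomial of degree below k yields the curve of degree k - 1; three
      in degree k followed by four in degree k + 1 yield the common factor q.\<close>
    then consider (low) d where "d < k" "e d \<noteq> 0" | (flat) "\<forall>d<k. e d = 0" "e k = 3" "e (Suc k) = 4"
      using bound(2) assms(1,2) card_S by auto
    then show "?A \<or> ?B"
    proof cases
      case low
      then obtain u where u: "u \<in> lead_mons X" "mdeg u = d"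
        unfolding e_def by (metis (mono_tags, lifting) card.empty ex_in_conv mem_Collect_eq)
      \<comment> \<open>Multiplication by a power of x raises the degree to exactly k - 1.\<close>
      have "u + (k - 1 - d, 0) \<in> lead_mons X" using lead_mons_add[OF u(1)] .
      then obtain q where q: "\<forall>A\<in>X. ev q A = 0" "lead q (u + (k - 1 - d, 0))"
        unfolding lead_mons_def by blast
      have "has_degree (curry (mcoeff q)) (k - 1)"
        using lead_has_degree[OF q(2)] low(1) u(2) by simp
      with q(1) show ?thesis by (metis peval_mcoeff)
    next
      case flat
      obtain c b where cb: "c + b + 2 = k"
        "{u\<in>lead_mons X. mdeg u = k} = {(c, b + 2), (c + 1, b + 1), (c + 2, b)}"
        "{u\<in>lead_mons X. mdeg u = Suc k} = {(c, b + 3), (c + 1, b + 2), (c + 2, b + 1), (c + 3, b)}"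
        by (rule consecutive_mons_of_card_3_4[OF lead_mons_add flat(2,3)[unfolded e_def]])
      have low: "c + b + 2 \<le> mdeg u" if "u \<in> lead_mons X" for u
      proof (rule ccontr)
        assume "\<not> ?thesis"
        then have "e (mdeg u) = 0" using flat(1) cb(1) by simp
        then have "{v\<in>lead_mons X. mdeg v = mdeg u} = {}"
          unfolding e_def using finite_mdeg_eq by (metis card_0_eq)
        with that show False by blast
      qed
      have "Suc k = c + b + 3" using cb(1) by simp
      note deg' = cb(3)[unfolded this]
      obtain q m0 m1 m2 where q: "lead q (c, b)" and
        m: "lead m0 (2, 0)" "lead m1 (1, 1)" "lead m2 (0, 2)"
          "\<forall>A\<in>X. ev q A \<noteq> 0 \<longrightarrow> ev m0 A = 0 \<and> ev m1 A = 0 \<and> ev m2 A = 0"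
        by (rule common_factor_of_consecutive[OF low cb(2)[folded cb(1)] deg'])
      let ?Z = "{A\<in>X. ev q A \<noteq> 0}" and ?Y = "{A\<in>X. ev q A = 0}"
      have "(2, 0) \<in> lead_mons ?Z" "(1, 1) \<in> lead_mons ?Z" "(0, 2) \<in> lead_mons ?Z"
        using m unfolding lead_mons_def by blast+
      note Z2 = this[THEN lead_mons_add]
      \<comment> \<open>Modulo the three quadrics only 1, x and y can remain standard, so
        independence allows at most three nodes off q.\<close>
      have "{u. mdeg u \<le> n} - lead_mons ?Z \<subseteq> {(0, 0), (1, 0), (0, 1)}"
      proof
        fix u assume u: "u \<in> {u. mdeg u \<le> n} - lead_mons ?Z"
        have ne: "u \<noteq> (2, 0) + v" "u \<noteq> (0, 2) + v" for v
          using u Z2(1)[of v] Z2(3)[of v] by blast+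
        have "fst u < 2"
        proof (rule ccontr)
          assume "\<not> ?thesis"
          then have "u = (2, 0) + (u - (2, 0))" by (simp add: prod_eq_iff)
          with ne(1) show False by blast
        qed
        moreover have "snd u < 2"
        proof (rule ccontr)
          assume "\<not> ?thesis"
          then have "u = (0, 2) + (u - (0, 2))" by (simp add: prod_eq_iff)
          with ne(2) show False by blast
        qed
        moreover have "u \<noteq> (1, 1)" using u Z2(2)[of "(0, 0)"] by auto
        ultimately show "u \<in> {(0, 0), (1, 0), (0, 1)}"
          by (cases u) (auto simp: less_2_cases_iff)
      qed
      then have "card ({u. mdeg u \<le> n} - lead_mons ?Z) \<le> card {(0::nat, 0::nat), (1, 0), (0, 1)}"
        by (intro card_mono) auto
      moreover have "card ?Z \<le> card ({u. mdeg u \<le> n} - lead_mons ?Z)"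
        using assms(3) n_independent_subset[OF assms(4)] by (intro card_n_independent_le) auto
      ultimately have "card ?Z \<le> 3" by simp
      moreover have "card ?Y \<le> dd n (mdeg (c, b))"
        by (rule curve_card_le[OF _ n_independent_subset[OF assms(4)] q])
          (use assms(2,3) cb(1) in simp_all)
      moreover have "mdeg (c, b) = k - 2" using cb(1) by simp
      moreover have "card X = card ?Y + card ?Z"
        using assms(3) by (subst card_Un_disjoint[symmetric]) (auto intro: arg_cong[where f = card])
      \<comment> \<open>At most three nodes lie off q and at most \<open>dd n (k - 2)\<close> on it,
        so both bounds are attained; in particular q is maximal.\<close>
      ultimately have "card ?Z = 3" using assms(5) by simp
      moreover have "has_degree (curry (mcoeff q)) (k - 2)"
        using lead_has_degree[OF q] cb(1) by auto
      ultimately have ?B by (intro exI[of _ "curry (mcoeff q)"]) (simp add: peval_mcoeff)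
      then show ?thesis ..
    qed
  next
    assume "?A \<or> ?B"
    then have "\<exists>T\<subseteq>?S. 3 \<le> card T"
    proof
      assume ?A
      then obtain p where p: "has_degree p (k - 1)" "\<forall>A\<in>X. peval p A = 0" by blast
      obtain q u where q: "curry (mcoeff q) = p" "lead q u" "mdeg u = k - 1"
        using has_degree_lead[OF p(1)] .
      have u: "u \<in> lead_mons X"
        using p(2) q(2) unfolding q(1)[symmetric] peval_mcoeff lead_mons_def by blast
      \<comment> \<open>The leading monomials of q, x q and y q.\<close>
      have "card {u, u + (1, 0), u + (0, 1)} = 3" by (simp add: prod_eq_iff)
      moreover have "{u, u + (1, 0), u + (0, 1)} \<subseteq> ?S"
        using u lead_mons_add[OF u] q(3) assms(1) by auto
      ultimately show ?thesis by (intro exI[of _ "{u, u + (1, 0), u + (0, 1)}"]) simp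
    next
      assume ?B
      then obtain p where p: "has_degree p (k - 2)" "card {A\<in>X. peval p A \<noteq> 0} = 3" by blast
      obtain q u where q: "curry (mcoeff q) = p" "lead q u" "mdeg u = k - 2"
        using has_degree_lead[OF p(1)] .
      let ?Z = "{A\<in>X. ev q A \<noteq> 0}"
      let ?T = "{v\<in>lead_mons ?Z. mdeg v \<le> 2}"
      have "card ?Z = 3" using p(2) unfolding q(1)[symmetric] peval_mcoeff .
      \<comment> \<open>Three nodes impose at most three conditions on the six-dimensional space of
        polynomials of degree at most 2, so at least three leading monomials remain; the products
        with q vanish on all of X.\<close>
      then have "card ({v. mdeg v \<le> 2} - lead_mons ?Z) \<le> 3"
        using card_standard_le[of ?Z 2] assms(3) by simp
      moreover have "card {v. mdeg v \<le> 2} = card ({v. mdeg v \<le> 2} - lead_mons ?Z) + card ?T"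
        using finite_mdeg_le finite_lead_mons_le
        by (subst card_Un_disjoint[symmetric]) (auto intro: arg_cong[where f = card])
      ultimately have "3 \<le> card ((+) u ` ?T)"
        by (simp add: card_mdeg_le NN_def card_image)
      moreover have "(+) u ` ?T \<subseteq> ?S"
      proof
        fix w assume "w \<in> (+) u ` ?T"
        then obtain v where v: "w = u + v" "v \<in> lead_mons ?Z" "mdeg v \<le> 2" by blast
        then obtain r where r: "\<forall>A\<in>?Z. ev r A = 0" "lead r v" unfolding lead_mons_def by blast
        have "\<forall>A\<in>X. ev (q * r) A = 0" using r(1) by auto
        then have "w \<in> lead_mons X"
          using lead_mult(1)[OF q(2) r(2)] unfolding v(1) lead_mons_def by blast
        then show "w \<in> ?S" using v(1,3) q(3) assms(1) by simp
      qed
      ultimately show ?thesis by blast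
    qed
    then have "3 \<le> card ?S"
      using finite_lead_mons_le by (meson card_mono order_trans)
    with \<open>card ?S \<le> 3\<close> show "card ?S = 3" by simp
  qed
  moreover have "card ?S = 3 \<longleftrightarrow> 3 \<le> card ?S" using \<open>card ?S \<le> 3\<close> by auto
  ultimately show ?thesis
    using at_most lin_indep_vanishing_iff[of 3 k X] by blast
qed

end
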